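(* Let $G=(V,E)$ be a connected graph with $n=|V|\ge 3$, weights $w$ and costs $c$, and let $B>0$. Suppose there exists $F\subseteq E$ with $c(F)\le B$ and profit $p_G(F)=\Delta$. Then the procedure below outputs a set of cost at most $B$ whose profit is at least $$\frac{\Delta}{4}\left(\frac{1}{\log n}-\frac{1}{\log^2 n}\right)=\Omega\!\left(\frac{\Delta}{\log n}\right).$$ Procedure ($\mathcal{W}=\{w(e):e\in E\}$). Phase 1: for every $\{u,v\}\in E$ and $W\in\mathcal{W}$, let $C$ be a minimum-cost set of edges of $(V,\{f\in E:w(f)<W\})$ separating $u$ from $v$ in that graph; let $C_0$ be such a $C$ with $c(C)\le B$ maximizing $p_G(C)$ ($C_0=\emptyset$ if none has positive profit). Phase 2: set $G'=(V,E')=G$, $F_g=\emptyset$, $b=0$; repeat: for every $\{u,v\}\in E'$ and $W\in\mathcal{W}$ let $C$ be a minimum-cost set of edges of $(V,\{f\in E':w(f)<W\})$ separating $u$ from $v$ in that graph and $p=W-w(\{u,v\})$; among those with $b<b+c(C)\le B$ pick $C^*$ maximizing $p/c(C)$ with maximum value $r^*$ ($r^*=0$, $C^*=\emptyset$ if no candidate has positive ratio); set $G'\leftarrow G'\setminus C^*$, $b\leftarrow b+c(C^* )$, $F_g\leftarrow F_g\cup C^*$; continue while $r^*>0$. Output $C_0$ if $p_G(C_0)\ge p_G(F_g)$, otherwise output $F_g$.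
   Context: $w:E\to\mathbb{R}_{\ge0}$, $c:E\to\mathbb{R}_{>0}$, $c(D)=\sum_{f\in D}c(f)$, $G\setminus D=(V,E\setminus D)$. $\mathrm{MST}(\cdot)$ is minimum spanning tree weight w.r.t. $w$ ($\infty$ for disconnected graphs); $p_G(D)=\mathrm{MST}(G\setminus D)-\mathrm{MST}(G)$ is the profit of $D$. $\log=\log_2$.
   Formalization: Δ is assumed finite, i.e. G∖F is connected; for Δ = ∞ the claim fails (triangle with unit weights and costs, B = 2: the procedure outputs ∅ with profit 0). The closing Ω(Δ/log n) form, immediate for n ≥ 3, is not stated. *)

theory Defs
  imports "HOL-Analysis.Analysis" "HOL-Library.Extended_Real"
begin

definition simple_graph :: "'v set \<Rightarrow> 'v set set \<Rightarrow> bool" where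
  "simple_graph V E \<longleftrightarrow> finite V \<and> (\<forall>e\<in>E. \<exists>u v. e = {u, v} \<and> u \<in> V \<and> v \<in> V \<and> u \<noteq> v)"

definition reachable :: "'v set set \<Rightarrow> 'v \<Rightarrow> 'v \<Rightarrow> bool" where
  "reachable H u v \<longleftrightarrow> (\<lambda>x y. {x, y} \<in> H)\<^sup>*\<^sup>* u v"

definition connected_on :: "'v set \<Rightarrow> 'v set set \<Rightarrow> bool" where
  "connected_on V H \<longleftrightarrow> (\<forall>u\<in>V. \<forall>v\<in>V. reachable H u v)"

definition spanning_tree :: "'v set \<Rightarrow> 'v set set \<Rightarrow> 'v set set \<Rightarrow> bool" where
  "spanning_tree V E T \<longleftrightarrow> T \<subseteq> E \<and> connected_on V T \<and> (\<forall>e\<in>T. \<not> connected_on V (T - {e}))"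

definition mst :: "'v set \<Rightarrow> 'v set set \<Rightarrow> ('v set \<Rightarrow> real) \<Rightarrow> ereal" where
  "mst V E w = (if \<exists>T. spanning_tree V E T
      then ereal (Min {sum w T | T. spanning_tree V E T}) else \<infinity>)"

definition profit :: "'v set \<Rightarrow> 'v set set \<Rightarrow> ('v set \<Rightarrow> real) \<Rightarrow> 'v set set \<Rightarrow> ereal" where
  "profit V E w D = mst V (E - D) w - mst V E w"

definition cost :: "('v set \<Rightarrow> real) \<Rightarrow> 'v set set \<Rightarrow> real" where
  "cost c D = sum c D"

definition min_sep :: "'v set set \<Rightarrow> ('v set \<Rightarrow> real) \<Rightarrow> 'v \<Rightarrow> 'v \<Rightarrow> 'v set set \<Rightarrow> bool" where
  "min_sep H c u v C \<longleftrightarrow> C \<subseteq> H \<and> \<not> reachable (H - C) u v \<and>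
     (\<forall>C'. C' \<subseteq> H \<and> \<not> reachable (H - C') u v \<longrightarrow> cost c C \<le> cost c C')"

definition cut_choice ::
  "'v set set \<Rightarrow> 'v set set \<Rightarrow> ('v set \<Rightarrow> real) \<Rightarrow> ('v set \<Rightarrow> real) \<Rightarrow> ('v \<Rightarrow> 'v \<Rightarrow> real \<Rightarrow> 'v set set) \<Rightarrow> bool" where
  "cut_choice E E1 w c Cut \<longleftrightarrow>
     (\<forall>u v W. {u, v} \<in> E1 \<and> W \<in> w ` E \<longrightarrow>
        min_sep {f \<in> E1. w f < W} c u v (Cut u v W) \<and> Cut u v W = Cut v u W)"

text \<open>Possible results C0 of Phase 1 (over all tie-breaking choices).\<close>
definition phase1_result ::
  "'v set \<Rightarrow> 'v set set \<Rightarrow> ('v set \<Rightarrow> real) \<Rightarrow> ('v set \<Rightarrow> real) \<Rightarrow> real \<Rightarrow> 'v set set \<Rightarrow> bool" where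
  "phase1_result V E w c B C0 \<longleftrightarrow> (\<exists>Cut. cut_choice E E w c Cut \<and>
     (let cands = {Cut u v W | u v W. {u, v} \<in> E \<and> W \<in> w ` E \<and> cost c (Cut u v W) \<le> B} in
       (C0 \<in> cands \<and> profit V E w C0 > 0 \<and> (\<forall>C\<in>cands. profit V E w C \<le> profit V E w C0))
     \<or> ((\<forall>C\<in>cands. profit V E w C \<le> 0) \<and> C0 = {})))"

definition phase2_step ::
  "'v set set \<Rightarrow> ('v set \<Rightarrow> real) \<Rightarrow> ('v set \<Rightarrow> real) \<Rightarrow> real \<Rightarrow>
   'v set set \<times> real \<times> 'v set set \<Rightarrow> real \<Rightarrow> 'v set set \<times> real \<times> 'v set set \<Rightarrow> bool" where
  "phase2_step E w c B st r st' \<longleftrightarrow> (case st of (E1, b, Fg) \<Rightarrow>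
     (\<exists>Cut Cs. cut_choice E E1 w c Cut \<and>
       (let cands = {(u, v, W) | u v W. {u, v} \<in> E1 \<and> W \<in> w ` E \<and>
                        b < b + cost c (Cut u v W) \<and> b + cost c (Cut u v W) \<le> B};
            ratio = (\<lambda>(u, v, W). (W - w {u, v}) / cost c (Cut u v W))
        in ((\<exists>x\<in>cands. ratio x > 0 \<and> (\<forall>y\<in>cands. ratio y \<le> ratio x) \<and>
                 r = ratio x \<and> Cs = (case x of (u, v, W) \<Rightarrow> Cut u v W))
            \<or> ((\<forall>y\<in>cands. ratio y \<le> 0) \<and> r = 0 \<and> Cs = {}))) \<and>
       st' = (E1 - Cs, b + cost c Cs, Fg \<union> Cs)))"

definition phase2_result ::
  "'v set set \<Rightarrow> ('v set \<Rightarrow> real) \<Rightarrow> ('v set \<Rightarrow> real) \<Rightarrow> real \<Rightarrow> 'v set set \<Rightarrow> bool" where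
  "phase2_result E w c B Fg \<longleftrightarrow> (\<exists>k s r. k \<ge> 1 \<and> s 0 = (E, 0, {}) \<and>
     (\<forall>i<k. phase2_step E w c B (s i) (r i) (s (Suc i))) \<and>
     (\<forall>i<k. (0 < r i) \<longleftrightarrow> Suc i < k) \<and>
     Fg = snd (snd (s k)))"

definition procedure_output ::
  "'v set \<Rightarrow> 'v set set \<Rightarrow> ('v set \<Rightarrow> real) \<Rightarrow> ('v set \<Rightarrow> real) \<Rightarrow> real \<Rightarrow> 'v set set \<Rightarrow> bool" where
  "procedure_output V E w c B Out \<longleftrightarrow> (\<exists>C0 Fg. phase1_result V E w c B C0 \<and> phase2_result E w c B Fg \<and>
     Out = (if profit V E w C0 \<ge> profit V E w Fg then C0 else Fg))"

end

theory Submission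
  imports Defs
begin

text \<open>Run Kruskal's algorithm on a minimum spanning tree of \<open>G - F\<close> and let \<open>S i\<close> be the smaller of the
  two components joined by the \<open>i\<close>-th edge, of weight \<open>W i\<close>. Edges of \<open>G\<close> lighter than \<open>W i\<close> that
  leave \<open>S i\<close> lie in \<open>F\<close>; let \<open>K i\<close> be their cost. A vertex lies in at most \<open>log n\<close> of the sets \<open>S i\<close>,
  since its component at least doubles each time, so the \<open>K i\<close> sum up to at most \<open>2 B log n\<close>.
  By edge exchanges, every spanning tree \<open>T\<close> of a subgraph \<open>G'\<close> contains distinct edges \<open>\<phi> i\<close> leaving
  \<open>S i\<close>; for a minimum spanning tree of \<open>G'\<close> the gains \<open>W i - w (\<phi> i)\<close> sum up to at least
  \<open>\<Delta>\<close> minus the profit made so far.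
  If neither phase reaches the claimed profit \<open>\<tau>\<close>, every gain is at most \<open>\<tau>\<close>, and averaging shows that
  the greedy phase sees a ratio above \<open>2 \<tau> / B\<close> as long as at most \<open>B / 2\<close> has been spent. Hence it
  spends more than \<open>B / 2\<close> at this rate and does make profit \<open>\<tau>\<close>.\<close>

section \<open>Reachability, components and edge exchange\<close>

definition crosses :: "'v set \<Rightarrow> 'v set \<Rightarrow> bool" where
  "crosses f S \<longleftrightarrow> (\<exists>p q. f = {p, q} \<and> p \<in> S \<and> q \<notin> S)"

definition component :: "'v set set \<Rightarrow> 'v \<Rightarrow> 'v set" where
  "component H x = {y. reachable H x y}"

lemma reachable_refl [simp]: "reachable H x x"
  by (simp add: reachable_def)

lemma reachable_trans: "reachable H x y \<Longrightarrow> reachable H y z \<Longrightarrow> reachable H x z"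
  unfolding reachable_def by (rule rtranclp_trans)

lemma reachable_edge: "{x, y} \<in> H \<Longrightarrow> reachable H x y"
  unfolding reachable_def by (rule r_into_rtranclp)

lemma reachable_if_edges_reachable:
  assumes "reachable H x y" and "\<And>p q. {p, q} \<in> H \<Longrightarrow> reachable H' p q"
  shows "reachable H' x y"
  using assms(1) unfolding reachable_def
proof (induction rule: rtranclp_induct)
  case base
  then show ?case by simp
next
  case (step y z)
  then show ?case
    using assms(2)[of y z] unfolding reachable_def by (meson rtranclp_trans)
qed

lemma reachable_mono: "reachable H x y \<Longrightarrow> H \<subseteq> H' \<Longrightarrow> reachable H' x y"
  by (erule reachable_if_edges_reachable) (auto intro: reachable_edge)

lemma reachable_sym: "reachable H x y \<Longrightarrow> reachable H y x"
  unfolding reachable_def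
proof (induction rule: rtranclp_induct)
  case base
  then show ?case by simp
next
  case (step y z)
  then have "{z, y} \<in> H" by (simp add: insert_commute)
  then show ?case using step(3) by (rule converse_rtranclp_into_rtranclp)
qed

lemma crosses_pair: "crosses {p, q} S \<longleftrightarrow> (p \<in> S) \<noteq> (q \<in> S)"
  unfolding crosses_def by (auto simp: doubleton_eq_iff)

lemma reachable_not_crosses:
  assumes "reachable H x y" and "\<And>f. f \<in> H \<Longrightarrow> \<not> crosses f S"
  shows "x \<in> S \<longleftrightarrow> y \<in> S"
  using assms(1) unfolding reachable_def
proof (induction rule: rtranclp_induct)
  case base
  then show ?case by simp
next
  case (step y z)
  then show ?case using assms(2) crosses_pair by metis
qed

lemma not_crosses_component: "f \<in> H \<Longrightarrow> \<not> crosses f (component H x)"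
  unfolding crosses_def component_def
  by (auto dest: reachable_edge intro: reachable_trans)

lemma component_eq: "reachable H x y \<Longrightarrow> component H x = component H y"
  unfolding component_def by (auto intro: reachable_trans reachable_sym)

lemma component_mono: "H \<subseteq> H' \<Longrightarrow> component H x \<subseteq> component H' x"
  unfolding component_def by (auto intro: reachable_mono)

text \<open>Taking the last edge of a path from \<open>x\<close> to \<open>y\<close> that leaves the component of \<open>x\<close> avoids
  having to speak about simple paths.\<close>
lemma edge_exchange:
  assumes conn: "connected_on V H" and sub: "H0 \<subseteq> H" and xy: "x \<in> V" "y \<in> V"
    and sep: "\<not> reachable H0 x y"
  obtains f where "f \<in> H" "crosses f (component H0 x)"
    "connected_on V (insert {x, y} (H - {f}))"
proof -
  define S where "S = component H0 x"
  define N where "N = {g \<in> H. \<not> crosses g S}"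
  have xS: "x \<in> S" and yS: "y \<notin> S"
    using sep by (auto simp: S_def component_def)
  have N_closed: "z \<in> S \<longleftrightarrow> z' \<in> S" if "reachable N z z'" for z z'
    using reachable_not_crosses[OF that] by (auto simp: N_def)
  have "(\<lambda>a b. {a, b} \<in> H)\<^sup>*\<^sup>* x y"
    using conn xy unfolding connected_on_def reachable_def by blast
  then have "reachable N x y \<or> (\<exists>p q. p \<in> S \<and> q \<notin> S \<and> {p, q} \<in> H \<and> reachable N q y)"
  proof (induction rule: converse_rtranclp_induct)
    case base
    then show ?case by simp
  next
    case (step z z')
    show ?case
    proof (cases "reachable N z' y")
      case True
      then have "z' \<notin> S" using N_closed yS by blast
      show ?thesis
      proof (cases "z \<in> S")
        case True
        then show ?thesis using \<open>z' \<notin> S\<close> \<open>reachable N z' y\<close> step(1) by blast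
      next
        case False
        then have "{z, z'} \<in> N"
          using step(1) \<open>z' \<notin> S\<close> by (simp add: N_def crosses_pair)
        then show ?thesis using \<open>reachable N z' y\<close> reachable_edge reachable_trans by metis
      qed
    next
      case False
      then show ?thesis using step by blast
    qed
  qed
  then obtain p q where pq: "p \<in> S" "q \<notin> S" "{p, q} \<in> H" "reachable N q y"
    using N_closed xS yS by blast
  \<comment> \<open>After the swap \<open>p\<close> reaches \<open>x\<close> inside
    \<open>H0\<close>, then \<open>y\<close> by the new edge, then \<open>q\<close> inside
    \<open>N\<close>. No edge of \<open>H0\<close> or \<open>N\<close> crosses \<open>S\<close>, so
    this detour survives the removal of \<open>{p, q}\<close>.\<close>
  define H' where "H' = insert {x, y} (H - {{p, q}})"
  have "N \<subseteq> H'"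
    using pq by (auto simp: N_def H'_def crosses_pair)
  have "H0 \<subseteq> H'"
    using sub not_crosses_component[of _ H0 x] pq crosses_pair[of p q S]
    by (auto simp: H'_def S_def)
  have "reachable H' p x"
    using \<open>H0 \<subseteq> H'\<close> pq(1) by (auto simp: S_def component_def intro: reachable_sym reachable_mono)
  moreover have "reachable H' x y"
    by (rule reachable_edge) (simp add: H'_def)
  moreover have "reachable H' y q"
    using pq(4) \<open>N \<subseteq> H'\<close> by (auto intro: reachable_sym reachable_mono)
  ultimately have "reachable H' p q" by (blast intro: reachable_trans)
  then have "reachable H' a b" if "{a, b} \<in> H" for a b
    using that reachable_sym reachable_edge[of a b H']
    by (cases "{a, b} = {p, q}") (auto simp: H'_def doubleton_eq_iff)
  then have "connected_on V H'"
    using conn unfolding connected_on_def by (blast intro: reachable_if_edges_reachable)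
  then show ?thesis
    using that[of "{p, q}"] pq by (simp add: H'_def S_def crosses_pair)
qed

section \<open>Simple graphs and minimum spanning trees\<close>

lemma simple_graph_finite: "simple_graph V E \<Longrightarrow> finite E"
  unfolding simple_graph_def by (rule finite_subset[of _ "Pow V"]) auto

lemma simple_graph_mono: "simple_graph V E \<Longrightarrow> H \<subseteq> E \<Longrightarrow> simple_graph V H"
  unfolding simple_graph_def by blast

lemma simple_graph_edge:
  assumes "simple_graph V E" "{u, v} \<in> E"
  shows "u \<in> V" "v \<in> V" "u \<noteq> v"
proof -
  obtain a b where "{u, v} = {a, b}" "a \<in> V" "b \<in> V" "a \<noteq> b"
    using assms unfolding simple_graph_def by blast
  then show "u \<in> V" "v \<in> V" "u \<noteq> v" by (auto simp: doubleton_eq_iff)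
qed

lemma simple_graphE:
  assumes "simple_graph V E" "e \<in> E"
  obtains u v where "e = {u, v}" "u \<in> V" "v \<in> V" "u \<noteq> v"
  using assms unfolding simple_graph_def by meson

lemma component_subset:
  assumes "simple_graph V H" "x \<in> V"
  shows "component H x \<subseteq> V"
proof
  fix y assume "y \<in> component H x"
  then have "reachable H x y" by (simp add: component_def)
  then show "y \<in> V"
    using reachable_not_crosses[of H x y V] assms unfolding simple_graph_def
    by (metis crosses_pair)
qed

lemma ex_spanning_tree_subset:
  assumes "finite H" "connected_on V H"
  shows "\<exists>T\<subseteq>H. spanning_tree V H T"
  using assms
proof (induction H rule: finite_psubset_induct)
  case (psubset H)
  show ?case
  proof (cases "\<exists>e\<in>H. connected_on V (H - {e})")
    case True
    then obtain e where e: "e \<in> H" "connected_on V (H - {e})" by blast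
    then obtain T where "T \<subseteq> H - {e}" "spanning_tree V (H - {e}) T"
      using psubset.IH[of "H - {e}"] by auto
    then show ?thesis unfolding spanning_tree_def by (meson Diff_subset subset_trans)
  next
    case False
    then show ?thesis using psubset unfolding spanning_tree_def by blast
  qed
qed

lemma finite_spanning_tree_weights: "finite E \<Longrightarrow> finite {sum w T | T. spanning_tree V E T}"
  by (rule finite_surj[of "Pow E" _ "sum w"]) (auto simp: spanning_tree_def)

text \<open>A spanning tree inside \<open>H\<close> drops only edges of nonnegative weight. Exchange
  arguments therefore only have to produce connected sets, not trees.\<close>

lemma mst_le_connected:
  assumes "finite E" "\<forall>e\<in>E. w e \<ge> 0" "H \<subseteq> E" "connected_on V H"
  shows "mst V E w \<le> ereal (sum w H)"
proof -
  have "finite H" using assms finite_subset by blast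
  then obtain T where T: "T \<subseteq> H" "spanning_tree V H T"
    using ex_spanning_tree_subset assms by blast
  then have st: "spanning_tree V E T" using assms unfolding spanning_tree_def by blast
  have "Min {sum w T | T. spanning_tree V E T} \<le> sum w T"
    using st finite_spanning_tree_weights[OF assms(1)] by (intro Min_le) auto
  also have "\<dots> \<le> sum w H"
    using T assms \<open>finite H\<close> by (intro sum_mono2) auto
  finally show ?thesis using st unfolding mst_def by auto
qed

lemma ex_minimum_spanning_tree:
  assumes "finite E" "connected_on V E"
  obtains T where "spanning_tree V E T" "mst V E w = ereal (sum w T)"
proof -
  have ex: "\<exists>T. spanning_tree V E T" using ex_spanning_tree_subset[OF assms] by blast
  have "Min {sum w T | T. spanning_tree V E T} \<in> {sum w T | T. spanning_tree V E T}"
    using ex finite_spanning_tree_weights[OF assms(1)] by (intro Min_in) auto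
  then show ?thesis using that ex unfolding mst_def by auto
qed

lemma connected_on_mono: "connected_on V H \<Longrightarrow> H \<subseteq> H' \<Longrightarrow> connected_on V H'"
  unfolding connected_on_def by (blast intro: reachable_mono)

lemma mst_not_infinity_imp_connected: "mst V E w \<noteq> \<infinity> \<Longrightarrow> connected_on V E"
  unfolding mst_def spanning_tree_def by (metis connected_on_mono)

lemma mst_antimono:
  assumes "finite E" "\<forall>e\<in>E. w e \<ge> 0" "H \<subseteq> E"
  shows "mst V E w \<le> mst V H w"
proof (cases "connected_on V H")
  case True
  then obtain T where "spanning_tree V H T" "mst V H w = ereal (sum w T)"
    using ex_minimum_spanning_tree assms finite_subset by metis
  then show ?thesis
    using mst_le_connected[of E w T V] assms unfolding spanning_tree_def by auto
next
  case False
  then show ?thesis using mst_not_infinity_imp_connected by (metis ereal_less_eq(1))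
qed

text \<open>The edges of weight below \<open>W\<close> in a minimum spanning tree of
  \<open>H\<close> do not join \<open>u\<close> and \<open>v\<close>. Exchanging a tree edge of
  weight at least \<open>W\<close> for \<open>{u, v}\<close> gives a connected subset of
  \<open>E\<close> and saves at least \<open>W - w {u, v}\<close>.\<close>

lemma mst_separating_set:
  assumes E: "simple_graph V E" "\<forall>e\<in>E. w e \<ge> 0" and uv: "{u, v} \<in> E" and "H \<subseteq> E"
    and sep: "\<not> reachable {f \<in> H. w f < W} u v"
  shows "mst V E w + ereal (W - w {u, v}) \<le> mst V H w"
proof (cases "connected_on V H")
  case True
  have fin: "finite E" "finite H"
    using simple_graph_finite[OF E(1)] \<open>H \<subseteq> E\<close> finite_subset by auto
  obtain T where T: "spanning_tree V H T" "mst V H w = ereal (sum w T)"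
    using ex_minimum_spanning_tree[OF fin(2) True] by blast
  have TE: "T \<subseteq> E" and conn: "connected_on V T" and finT: "finite T"
    using T \<open>H \<subseteq> E\<close> fin unfolding spanning_tree_def by (auto intro: finite_subset)
  let ?T0 = "{f \<in> T. w f < W}"
  have "\<not> reachable ?T0 u v"
    using sep reachable_mono[of ?T0 u v "{f \<in> H. w f < W}"] T unfolding spanning_tree_def by blast
  then obtain f where f: "f \<in> T" "crosses f (component ?T0 u)"
    "connected_on V (insert {u, v} (T - {f}))"
    using edge_exchange[OF conn, of ?T0 u v] simple_graph_edge[OF E(1) uv] by blast
  then have "w f \<ge> W" using not_crosses_component[of f ?T0 u] by force
  have "mst V E w \<le> ereal (sum w (insert {u, v} (T - {f})))"
    using mst_le_connected[OF fin(1) E(2) _ f(3)] TE uv by blast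
  \<comment> \<open>An inequality is enough and spares excluding that \<open>{u, v}\<close> lies in
    \<open>T - {f}\<close>.\<close>
  also have "sum w (insert {u, v} (T - {f})) \<le> w {u, v} + (sum w T - w f)"
    using finT f(1) uv E(2) by (simp add: sum.insert_if sum_diff1)
  also have "\<dots> \<le> sum w T - (W - w {u, v})" using \<open>w f \<ge> W\<close> by simp
  finally have "mst V E w \<le> ereal (sum w T - (W - w {u, v}))" by simp
  then show ?thesis using T(2) by (cases "mst V E w") auto
next
  case False
  then show ?thesis using mst_not_infinity_imp_connected by (metis ereal_less_eq(1))
qed

text \<open>Otherwise a tree edge leaving the component of \<open>p\<close> among the tree edges up
  to weight \<open>w {p, q}\<close> is heavier than \<open>{p, q}\<close>, and exchanging it for
  \<open>{p, q}\<close> beats the minimum.\<close>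

lemma minimum_spanning_tree_bottleneck:
  assumes E: "simple_graph V E" "\<forall>e\<in>E. w e \<ge> 0"
    and T: "spanning_tree V E T" "mst V E w = ereal (sum w T)" and pq: "{p, q} \<in> E"
  shows "reachable {h \<in> T. w h \<le> w {p, q}} p q"
proof (rule ccontr)
  let ?T0 = "{h \<in> T. w h \<le> w {p, q}}"
  assume neg: "\<not> reachable ?T0 p q"
  have fin: "finite E" "finite T" and TE: "T \<subseteq> E" and conn: "connected_on V T"
    using simple_graph_finite[OF E(1)] T unfolding spanning_tree_def
    by (auto intro: finite_subset)
  obtain f where f: "f \<in> T" "crosses f (component ?T0 p)"
    "connected_on V (insert {p, q} (T - {f}))"
    using edge_exchange[OF conn _ _ _ neg] simple_graph_edge[OF E(1) pq] by blast
  then have "w f > w {p, q}" using not_crosses_component[of f ?T0 p] by force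
  have "mst V E w \<le> ereal (sum w (insert {p, q} (T - {f})))"
    using mst_le_connected[OF fin(1) E(2) _ f(3)] TE pq by blast
  also have "sum w (insert {p, q} (T - {f})) \<le> w {p, q} + (sum w T - w f)"
    using fin f(1) pq E(2) by (simp add: sum.insert_if sum_diff1)
  finally show False using T(2) \<open>w f > w {p, q}\<close> by simp
qed

section \<open>The merge sequence of a spanning tree\<close>

text \<open>The edges \<open>e 0, e 1, \<dots>\<close> are added one by one, each joining two different components;
  \<open>S i\<close> is the smaller of the two components joined by \<open>e i\<close>.\<close>
definition merge_sequence :: "'v set \<Rightarrow> nat \<Rightarrow> (nat \<Rightarrow> 'v set) \<Rightarrow> (nat \<Rightarrow> 'v set) \<Rightarrow> bool" where
  "merge_sequence V m e S \<longleftrightarrow> (\<forall>i<m. \<exists>a\<in>V. \<exists>b\<in>V. e i = {a, b} \<and> a \<noteq> b \<and>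
     S i = component (e ` {..<i}) a \<and> b \<notin> S i \<and> card (S i) \<le> card (component (e ` {..<i}) b))"

lemma merge_sequence_simple_graph:
  assumes "merge_sequence V m e S" "finite V" "i \<le> m"
  shows "simple_graph V (e ` {..<i})"
  unfolding simple_graph_def
proof (intro conjI ballI)
  fix f assume "f \<in> e ` {..<i}"
  then obtain j where "j < m" "f = e j"
    using assms(3) by (metis imageE lessThan_iff less_le_trans)
  then show "\<exists>u v. f = {u, v} \<and> u \<in> V \<and> v \<in> V \<and> u \<noteq> v"
    using assms(1) unfolding merge_sequence_def by metis
qed (use assms in auto)

text \<open>Whenever \<open>x\<close> lies in \<open>S i\<close>, its component is merged with a
  disjoint one that is at least as large.\<close>

lemma merge_sequence_card:
  assumes ms: "merge_sequence V m e S" and V: "finite V" and x: "x \<in> V" and "i \<le> m"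
  shows "2 ^ card {j. j < i \<and> x \<in> S j} \<le> card (component (e ` {..<i}) x)"
  using \<open>i \<le> m\<close>
proof (induction i)
  case 0
  have "finite (component (e ` {..<0}) x)" "x \<in> component (e ` {..<0}) x"
    using component_subset[OF merge_sequence_simple_graph[OF ms V 0] x] V finite_subset
    by (auto simp: component_def)
  then show ?case by (auto simp: Suc_le_eq card_gt_0_iff)
next
  case (Suc i)
  let ?A = "e ` {..<i}" and ?A' = "e ` {..<Suc i}"
  have fin: "finite (component ?A z)" "finite (component ?A' z)" if "z \<in> V" for z
    using component_subset[OF merge_sequence_simple_graph[OF ms V Suc.prems] that]
      component_subset[OF merge_sequence_simple_graph[OF ms V Suc_leD[OF Suc.prems]] that]
    by (auto intro: finite_subset[OF _ V])
  have sub: "component ?A z \<subseteq> component ?A' z" for z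
    by (rule component_mono) auto
  show ?case
  proof (cases "x \<in> S i")
    case True
    obtain a b where ab: "a \<in> V" "b \<in> V" "e i = {a, b}" "S i = component ?A a" "b \<notin> S i"
      "card (S i) \<le> card (component ?A b)"
      using ms Suc.prems unfolding merge_sequence_def by (metis Suc_le_lessD)
    have xa: "component ?A x = component ?A a"
      using True component_eq[of ?A a x] ab by (auto simp: component_def)
    have "reachable ?A' a b" by (rule reachable_edge) (use ab in auto)
    have "reachable ?A' x a"
      using True ab sub[of a] by (auto simp: component_def intro: reachable_sym)
    then have eq: "component ?A' x = component ?A' a" "component ?A' a = component ?A' b"
      using component_eq[OF \<open>reachable ?A' x a\<close>] component_eq[OF \<open>reachable ?A' a b\<close>] by simp_all
    have disj: "component ?A a \<inter> component ?A b = {}"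
      using ab(4,5) by (auto simp: component_def intro: reachable_trans reachable_sym)
    have "{j. j < Suc i \<and> x \<in> S j} = insert i {j. j < i \<and> x \<in> S j}"
      using True by (auto simp: less_Suc_eq)
    then have "2 ^ card {j. j < Suc i \<and> x \<in> S j} = 2 * 2 ^ card {j. j < i \<and> x \<in> S j}"
      by simp
    also have "\<dots> \<le> 2 * card (component ?A x)" using Suc by simp
    also have "\<dots> \<le> card (component ?A a) + card (component ?A b)" using xa ab by simp
    also have "\<dots> = card (component ?A a \<union> component ?A b)"
      using disj fin ab by (simp add: card_Un_disjoint)
    also have "\<dots> \<le> card (component ?A' x)"
      using eq sub[of a] sub[of b] fin(2)[OF x] by (intro card_mono) auto
    finally show ?thesis .
  next
    case False
    then have "{j. j < Suc i \<and> x \<in> S j} = {j. j < i \<and> x \<in> S j}"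
      by (auto simp: less_Suc_eq)
    then show ?thesis
      using Suc card_mono[OF fin(2)[OF x] sub] by fastforce
  qed
qed

text \<open>While \<open>e i\<close> is added, an edge of \<open>T\<close> leaving \<open>S i\<close> is discarded such that the union of the
  remaining edges of \<open>T\<close> and the edges added so far stays connected.\<close>
lemma merge_sequence_transversal:
  assumes ms: "merge_sequence V m e S" and conn: "connected_on V T" and "i \<le> m"
  shows "\<exists>\<phi>. inj_on \<phi> {..<i} \<and> \<phi> ` {..<i} \<subseteq> T \<and> (\<forall>j<i. crosses (\<phi> j) (S j)) \<and>
    connected_on V ((T - \<phi> ` {..<i}) \<union> e ` {..<i})"
  using \<open>i \<le> m\<close>
proof (induction i)
  case 0
  then show ?case using conn by auto
next
  case (Suc i)
  let ?A = "e ` {..<i}"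
  obtain \<phi> where \<phi>: "inj_on \<phi> {..<i}" "\<phi> ` {..<i} \<subseteq> T" "\<forall>j<i. crosses (\<phi> j) (S j)"
    "connected_on V ((T - \<phi> ` {..<i}) \<union> ?A)" (is "connected_on V ?H")
    using Suc by auto
  obtain a b where ab: "a \<in> V" "b \<in> V" "e i = {a, b}" "S i = component ?A a" "b \<notin> S i"
    using ms Suc.prems unfolding merge_sequence_def by (metis Suc_le_lessD)
  then have "\<not> reachable ?A a b" by (simp add: component_def)
  then obtain f where f: "f \<in> ?H" "crosses f (S i)" "connected_on V (insert {a, b} (?H - {f}))"
    using edge_exchange[OF \<phi>(4), of ?A a b] ab by auto
  \<comment> \<open>Edges of \<open>?A\<close> lie inside components of \<open>?A\<close>, so
    \<open>f\<close> is an edge of \<open>T\<close> that was not discarded before. This keeps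
    \<open>\<psi>\<close> injective.\<close>
  have "f \<notin> ?A" using not_crosses_component[of f ?A a] f ab by auto
  define \<psi> where "\<psi> = \<phi>(i := f)"
  have img: "\<psi> ` {..<Suc i} = insert f (\<phi> ` {..<i})"
    by (auto simp: \<psi>_def lessThan_Suc)
  have "inj_on \<psi> {..<Suc i}"
    using \<phi>(1) f(1) \<open>f \<notin> ?A\<close> unfolding \<psi>_def lessThan_Suc inj_on_def by auto
  moreover have "\<psi> ` {..<Suc i} \<subseteq> T" using img \<phi>(2) f(1) \<open>f \<notin> ?A\<close> by auto
  moreover have "\<forall>j<Suc i. crosses (\<psi> j) (S j)" using \<phi>(3) f(2) by (simp add: \<psi>_def less_Suc_eq)
  moreover have "connected_on V ((T - \<psi> ` {..<Suc i}) \<union> e ` {..<Suc i})"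
    by (rule connected_on_mono[OF f(3)]) (use img ab(3) in \<open>auto simp: lessThan_Suc\<close>)
  ultimately show ?case by blast
qed

text \<open>Sorting the tree edges by weight gives the order of Kruskal's algorithm. By minimality
  of \<open>T\<close> the other tree edges do not join the ends of an edge, so each edge joins two
  components of its predecessors.\<close>

lemma spanning_tree_merge_sequence:
  assumes G: "simple_graph V E" and T: "spanning_tree V E T"
  obtains m e S where "merge_sequence V m e S" "bij_betw e {..<m} T"
    "\<forall>i j. i \<le> j \<and> j < m \<longrightarrow> (w (e i) :: real) \<le> w (e j)"
proof -
  have "finite T" using simple_graph_finite[OF G] T unfolding spanning_tree_def
    by (auto intro: finite_subset)
  then obtain ys where ys: "set ys = T" "distinct ys" using finite_distinct_list by blast
  define xs where "xs = sort_key w ys"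
  define m where "m = length xs"
  define e where "e i = xs ! i" for i
  have xs: "set xs = T" "distinct xs" "sorted (map w xs)" using ys by (auto simp: xs_def)
  have bij: "bij_betw e {..<m} T"
    using bij_betw_nth[OF xs(2), of "{..<m}" T] xs(1) by (simp add: m_def e_def[abs_def])
  have mono: "\<forall>i j. i \<le> j \<and> j < m \<longrightarrow> w (e i) \<le> w (e j)"
    using sorted_nth_mono[OF xs(3)] by (auto simp: m_def e_def)
  have "\<exists>S. \<exists>a\<in>V. \<exists>b\<in>V. e i = {a, b} \<and> a \<noteq> b \<and> S = component (e ` {..<i}) a \<and> b \<notin> S \<and>
      card S \<le> card (component (e ` {..<i}) b)" if "i < m" for i
  proof -
    let ?A = "e ` {..<i}"
    have "e i \<in> T" using bij that by (auto simp: bij_betw_def)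
    then obtain a b where ab: "e i = {a, b}" "a \<in> V" "b \<in> V" "a \<noteq> b"
      using G T unfolding simple_graph_def spanning_tree_def by blast
    have "e j \<in> T \<and> e j \<noteq> e i" if "j < i" for j
      using bij_betwE[OF bij] inj_on_eq_iff[OF bij_betw_imp_inj_on[OF bij], of j i] \<open>i < m\<close> that
      by simp
    then have "?A \<subseteq> T - {e i}" by blast
    moreover have "\<not> reachable (T - {e i}) a b"
    proof
      assume r: "reachable (T - {e i}) a b"
      have "reachable (T - {e i}) p q" if "{p, q} \<in> T" for p q
      proof (cases "{p, q} = e i")
        case True
        then have "p = a \<and> q = b \<or> p = b \<and> q = a" using ab(1) by (simp add: doubleton_eq_iff)
        then show ?thesis using r reachable_sym[OF r] by blast
      next
        case False
        then show ?thesis using that by (simp add: reachable_edge)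
      qed
      then have "connected_on V (T - {e i})"
        using T unfolding spanning_tree_def connected_on_def
        by (blast intro: reachable_if_edges_reachable)
      then show False using T \<open>e i \<in> T\<close> unfolding spanning_tree_def by blast
    qed
    ultimately have "\<not> reachable ?A a b" by (blast intro: reachable_mono)
    \<comment> \<open>Both are recorded because either end may be on the smaller side and then plays
      the role of \<open>a\<close> in \<open>merge_sequence\<close>.\<close>
    then have "b \<notin> component ?A a" "a \<notin> component ?A b"
      by (auto simp: component_def dest: reachable_sym)
    then show ?thesis
      using ab insert_commute[of a b "{}"] nle_le[of "card (component ?A a)" "card (component ?A b)"]
      by metis
  qed
  then obtain S where "merge_sequence V m e S"
    unfolding merge_sequence_def by metis
  then show ?thesis using that bij mono by blast
qed

text \<open>The \<open>W i\<close> are the sorted edge weights of a minimum spanning tree of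
  \<open>R\<close>. An edge of \<open>R\<close> lighter than \<open>W i\<close> has its ends joined
  by tree edges no heavier than itself; these precede the \<open>i\<close>-th one, so the edge stays
  inside a component. The last clause allows any connected \<open>T\<close>, since it is applied to
  graphs other than \<open>R\<close>.\<close>

lemma bottleneck_cut_family:
  fixes w :: "'v set \<Rightarrow> real"
  assumes R: "simple_graph V R" "\<forall>e\<in>R. w e \<ge> 0" "connected_on V R"
  obtains m :: nat and W :: "nat \<Rightarrow> real" and S :: "nat \<Rightarrow> 'v set" where
    "\<forall>i<m. W i \<in> w ` R" "mst V R w = ereal (\<Sum>i<m. W i)"
    "\<forall>i<m. \<forall>g\<in>R. w g < W i \<longrightarrow> \<not> crosses g (S i)"
    "\<forall>x\<in>V. 2 ^ card {i. i < m \<and> x \<in> S i} \<le> card V"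
    "\<forall>T. connected_on V T \<longrightarrow>
      (\<exists>\<phi>. inj_on \<phi> {..<m} \<and> \<phi> ` {..<m} \<subseteq> T \<and> (\<forall>i<m. crosses (\<phi> i) (S i)))"
proof -
  obtain T where T: "spanning_tree V R T" "mst V R w = ereal (sum w T)"
    using ex_minimum_spanning_tree[OF simple_graph_finite[OF R(1)] R(3)] by blast
  obtain m e S where ms: "merge_sequence V m e S" and bij: "bij_betw e {..<m} T"
    and mono: "\<forall>i j. i \<le> j \<and> j < m \<longrightarrow> w (e i) \<le> w (e j)"
    using spanning_tree_merge_sequence[OF R(1) T(1)] by blast
  have V: "finite V" using R(1) by (simp add: simple_graph_def)
  have TR: "T \<subseteq> R" using T(1) by (simp add: spanning_tree_def)
  have 1: "w (e i) \<in> w ` R" if "i < m" for i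
    using bij_betwE[OF bij] TR that by auto
  have 2: "mst V R w = ereal (\<Sum>i<m. w (e i))"
    using T(2) sum.reindex_bij_betw[OF bij, of w] by simp
  have 3: "\<not> crosses g (S i)" if i: "i < m" and g: "g \<in> R" "w g < w (e i)" for i g
  proof -
    obtain p q where pq: "g = {p, q}" using R(1) g(1) unfolding simple_graph_def by blast
    have prefix: "{h \<in> T. w h \<le> w g} \<subseteq> e ` {..<i}"
    proof
      fix h assume "h \<in> {h \<in> T. w h \<le> w g}"
      then obtain j where j: "j < m" "h = e j" "w (e j) < w (e i)"
        using bij_betw_imp_surj_on[OF bij] g(2) by force
      then have "j < i" using mono by (meson leI not_le)
      then show "h \<in> e ` {..<i}" using j by simp
    qed
    have r: "reachable (e ` {..<i}) p q"
      by (rule reachable_mono[OF minimum_spanning_tree_bottleneck[OF R(1,2) T g(1)[unfolded pq]]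
            prefix[unfolded pq]])
    obtain a where "S i = component (e ` {..<i}) a"
      using ms i unfolding merge_sequence_def by blast
    then have "p \<in> S i \<longleftrightarrow> q \<in> S i"
      using reachable_not_crosses[OF r, of "S i"] not_crosses_component by metis
    then show ?thesis by (simp add: pq crosses_pair)
  qed
  have 4: "2 ^ card {i. i < m \<and> x \<in> S i} \<le> card V" if "x \<in> V" for x
    using merge_sequence_card[OF ms V that order_refl]
      card_mono[OF V component_subset[OF merge_sequence_simple_graph[OF ms V order_refl] that]]
    by simp
  show ?thesis
    using that[of m "\<lambda>i. w (e i)" S] 1 2 3 4 merge_sequence_transversal[OF ms _ order_refl] by blast
qed

section \<open>Costs and profits of separating sets\<close>

text \<open>Double counting: an edge of \<open>F\<close> is paid at most once for each
  \<open>S i\<close> it crosses. Crossing needs an end in \<open>S i\<close>, and each of the two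
  ends lies in at most \<open>log 2 (card V)\<close> of these sets.\<close>

lemma sum_crossing_cost_le:
  fixes m :: nat
  assumes F: "simple_graph V F" "\<forall>f\<in>F. c f \<ge> 0" and "card V > 0"
    and S: "\<forall>x\<in>V. 2 ^ card {i. i < m \<and> x \<in> S i} \<le> card V"
  shows "(\<Sum>i<m. cost c {f \<in> F. crosses f (S i) \<and> w f < W i}) \<le> 2 * log 2 (card V) * cost c F"
proof -
  have fin: "finite F" by (rule simple_graph_finite[OF F(1)])
  have deg: "card {i. i < m \<and> x \<in> S i} \<le> log 2 (card V)" if "x \<in> V" for x
    using S that by (intro le_log2_of_power) blast
  have cr: "card {i. i < m \<and> crosses f (S i)} \<le> 2 * log 2 (card V)" if "f \<in> F" for f
  proof -
    obtain x y where f: "f = {x, y}" "x \<in> V" "y \<in> V"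
      using F(1) \<open>f \<in> F\<close> by (blast elim: simple_graphE)
    have "card {i. i < m \<and> crosses f (S i)} \<le> card ({i. i < m \<and> x \<in> S i} \<union> {i. i < m \<and> y \<in> S i})"
      by (rule card_mono) (auto simp: f(1) crosses_pair)
    also have "\<dots> \<le> card {i. i < m \<and> x \<in> S i} + card {i. i < m \<and> y \<in> S i}"
      by (rule card_Un_le)
    finally have "real (card {i. i < m \<and> crosses f (S i)})
        \<le> card {i. i < m \<and> x \<in> S i} + card {i. i < m \<and> y \<in> S i}"
      by linarith
    then show ?thesis using deg[OF f(2)] deg[OF f(3)] by linarith
  qed
  have "(\<Sum>i<m. cost c {f \<in> F. crosses f (S i) \<and> w f < W i})
      \<le> (\<Sum>i<m. sum c {f \<in> F. crosses f (S i)})"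
    unfolding cost_def using fin F(2) by (intro sum_mono sum_mono2) auto
  also have "\<dots> = (\<Sum>i<m. \<Sum>f\<in>F. if crosses f (S i) then c f else 0)"
    using fin by (simp add: sum.inter_filter)
  also have "\<dots> = (\<Sum>f\<in>F. \<Sum>i<m. if crosses f (S i) then c f else 0)"
    by (rule sum.swap)
  also have "\<dots> = (\<Sum>f\<in>F. card {i. i < m \<and> crosses f (S i)} * c f)"
    by (simp add: sum.inter_filter[symmetric])
  also have "\<dots> \<le> (\<Sum>f\<in>F. 2 * log 2 (card V) * c f)"
    using cr F(2) by (intro sum_mono mult_right_mono) auto
  finally show ?thesis by (simp add: cost_def sum_distrib_left)
qed

text \<open>Edges of \<open>H\<close> lighter than \<open>W\<close> that cross \<open>S\<close> all
  lie in \<open>F\<close>, and removing them already separates \<open>u\<close> from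
  \<open>v\<close>.\<close>

lemma min_sep_cost_le:
  assumes C: "min_sep {f \<in> H. w f < W} c u v C" and "u \<in> S" "v \<notin> S"
    and out: "\<forall>g\<in>H - F. w g < W \<longrightarrow> \<not> crosses g S"
    and F: "finite F" "\<forall>f\<in>F. c f \<ge> 0"
  shows "cost c C \<le> cost c {f \<in> F. crosses f S \<and> w f < W}"
proof -
  let ?D = "{f \<in> H \<inter> F. crosses f S \<and> w f < W}"
  have sep: "\<not> reachable ({f \<in> H. w f < W} - ?D) u v"
  proof
    assume "reachable ({f \<in> H. w f < W} - ?D) u v"
    then have "u \<in> S \<longleftrightarrow> v \<in> S"
      by (rule reachable_not_crosses) (use out in blast)
    then show False using assms by blast
  qed
  have "cost c C \<le> cost c C'"
    if "C' \<subseteq> {f \<in> H. w f < W}" "\<not> reachable ({f \<in> H. w f < W} - C') u v" for C'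
    using C that unfolding min_sep_def by blast
  from this[OF _ sep] have "cost c C \<le> cost c ?D" by blast
  also have "\<dots> \<le> cost c {f \<in> F. crosses f S \<and> w f < W}"
    unfolding cost_def using F by (intro sum_mono2) auto
  finally show ?thesis .
qed

text \<open>The edge \<open>{u, v}\<close> itself has to be cut. Positivity gives the greedy ratio a
  positive denominator and the strict increase of \<open>b\<close> demanded of a candidate.\<close>

lemma min_sep_cost_pos:
  assumes C: "min_sep {f \<in> H. w f < W} c u v C" and uv: "{u, v} \<in> H" "w {u, v} < W"
    and H: "finite H" "\<forall>f\<in>H. c f > 0"
  shows "cost c C > 0"
proof -
  have sub: "C \<subseteq> H" using C unfolding min_sep_def by blast
  have "{u, v} \<in> C"
    using C uv reachable_edge[of u v "{f \<in> H. w f < W} - C"] unfolding min_sep_def by blast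
  then show ?thesis
    unfolding cost_def using sub H by (intro sum_pos) (auto intro: finite_subset)
qed

lemma mst_min_sep:
  assumes "simple_graph V E" "\<forall>e\<in>E. w e \<ge> 0" "{u, v} \<in> E"
    and C: "min_sep {f \<in> E. w f < W} c u v C"
  shows "mst V E w + ereal (W - w {u, v}) \<le> mst V (E - C) w"
proof (rule mst_separating_set)
  have "{f \<in> E - C. w f < W} = {f \<in> E. w f < W} - C" by blast
  then show "\<not> reachable {f \<in> E - C. w f < W} u v" using C unfolding min_sep_def by simp
qed (use assms in auto)

lemma profit_min_sep:
  assumes "simple_graph V E" "\<forall>e\<in>E. w e \<ge> 0" "connected_on V E" "{u, v} \<in> E"
    and "min_sep {f \<in> E. w f < W} c u v C"
  shows "ereal (W - w {u, v}) \<le> profit V E w C"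
proof -
  obtain x where "mst V E w = ereal x"
    using ex_minimum_spanning_tree[OF simple_graph_finite] assms by metis
  then show ?thesis
    using mst_min_sep[OF assms(1,2,4,5)] unfolding profit_def by (cases "mst V (E - C) w") auto
qed

lemma profit_nonneg:
  assumes "simple_graph V E" "\<forall>e\<in>E. w e \<ge> 0" "connected_on V E"
  shows "profit V E w D \<ge> 0"
proof -
  obtain x where "mst V E w = ereal x"
    using ex_minimum_spanning_tree[OF simple_graph_finite] assms by metis
  then show ?thesis
    using mst_antimono[OF simple_graph_finite[OF assms(1)] assms(2), of "E - D" V]
    unfolding profit_def by (cases "mst V (E - D) w") auto
qed

section \<open>The two phases of the procedure\<close>

lemma phase1_result_cost:
  assumes "phase1_result V E w c B C0" and "B > 0"
  shows "cost c C0 \<le> B"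
proof -
  have "cost c {} \<le> B" using \<open>B > 0\<close> by (simp add: cost_def)
  then show ?thesis
    using assms(1) unfolding phase1_result_def Let_def by (elim exE conjE disjE) blast+
qed

text \<open>\<open>small\<close> speaks of all minimum separating sets because ties are broken
  arbitrarily. If the phase ends with \<open>C0 = {}\<close>, the candidate has profit at most 0
  while the profit of \<open>C0\<close> is nonnegative.\<close>

lemma phase1_result_profit:
  assumes ph: "phase1_result V E w c B C0"
    and E: "simple_graph V E" "\<forall>e\<in>E. w e \<ge> 0" "connected_on V E"
    and uv: "{u, v} \<in> E" "W \<in> w ` E"
    and small: "\<And>C. min_sep {f \<in> E. w f < W} c u v C \<Longrightarrow> cost c C \<le> B"
  shows "ereal (W - w {u, v}) \<le> profit V E w C0"
proof -
  obtain Cut where cut: "cut_choice E E w c Cut" and opt: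
    "\<And>C. C \<in> {Cut u v W | u v W. {u, v} \<in> E \<and> W \<in> w ` E \<and> cost c (Cut u v W) \<le> B} \<Longrightarrow>
      profit V E w C \<le> profit V E w C0 \<or> profit V E w C \<le> 0"
    using ph unfolding phase1_result_def Let_def by (elim exE conjE disjE) blast+
  have C: "min_sep {f \<in> E. w f < W} c u v (Cut u v W)"
    using cut uv unfolding cut_choice_def by blast
  have "ereal (W - w {u, v}) \<le> profit V E w (Cut u v W)"
    by (rule profit_min_sep[OF E uv(1) C])
  also have "\<dots> \<le> profit V E w C0"
  proof -
    have "Cut u v W \<in> {Cut u v W | u v W. {u, v} \<in> E \<and> W \<in> w ` E \<and> cost c (Cut u v W) \<le> B}"
      using uv small[OF C] by blast
    then show ?thesis using opt profit_nonneg[OF E, of C0] order_trans by blast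
  qed
  finally show ?thesis .
qed

text \<open>The first five facts maintain a state determined by the removed set alone. The sixth
  says that the cost of the step is turned into spanning tree weight at rate at least
  \<open>r\<close>, the seventh that no affordable cut has a better rate. There \<open>K\<close> is
  only an upper bound on the cut cost, as nothing sharper is known later.\<close>

lemma phase2_step_properties:
  assumes step: "phase2_step E w c B (E - D, cost c D, D) r (H', b', D')"
    and E: "simple_graph V E" "\<forall>e\<in>E. w e \<ge> 0" "\<forall>e\<in>E. c e > 0"
    and D: "D \<subseteq> E" "cost c D \<le> B"
  shows "H' = E - D'" "b' = cost c D'" "D \<subseteq> D'" "D' \<subseteq> E" "cost c D' \<le> B"
    "mst V (E - D) w + ereal (r * (cost c D' - cost c D)) \<le> mst V (E - D') w"
    "\<And>u v W K. \<lbrakk>{u, v} \<in> E - D; W \<in> w ` E; w {u, v} < W; cost c D + K \<le> B;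
        \<And>C. min_sep {f \<in> E - D. w f < W} c u v C \<Longrightarrow> cost c C \<le> K\<rbrakk> \<Longrightarrow>
      W - w {u, v} \<le> r * K"
proof -
  let ?H = "E - D"
  have finE: "finite E" by (rule simple_graph_finite[OF E(1)])
  have H: "simple_graph V ?H" "\<forall>e\<in>?H. w e \<ge> 0" "\<forall>e\<in>?H. c e > 0"
    using E simple_graph_mono[of V E ?H] by auto
  define cands where "cands Cut = {(u, v, W) | u v W. {u, v} \<in> ?H \<and> W \<in> w ` E \<and>
    cost c D < cost c D + cost c (Cut u v W) \<and> cost c D + cost c (Cut u v W) \<le> B}"
    for Cut :: "'a \<Rightarrow> 'a \<Rightarrow> real \<Rightarrow> 'a set set"
  define ratio where "ratio Cut = (\<lambda>(u, v, W). (W - w {u, v}) / cost c (Cut u v W))"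
    for Cut :: "'a \<Rightarrow> 'a \<Rightarrow> real \<Rightarrow> 'a set set"
  obtain Cut Cs where cut: "cut_choice E ?H w c Cut"
    and alt: "(\<exists>x\<in>cands Cut. ratio Cut x > 0 \<and> (\<forall>y\<in>cands Cut. ratio Cut y \<le> ratio Cut x) \<and>
                 r = ratio Cut x \<and> Cs = (case x of (u, v, W) \<Rightarrow> Cut u v W))
            \<or> ((\<forall>y\<in>cands Cut. ratio Cut y \<le> 0) \<and> r = 0 \<and> Cs = {})"
    and st': "H' = ?H - Cs" "b' = cost c D + cost c Cs" "D' = D \<union> Cs"
    using step unfolding phase2_step_def Let_def prod.case prod.inject cands_def ratio_def by blast
  have max: "ratio Cut y \<le> r" if "y \<in> cands Cut" for y
    using alt that by auto
  have sep: "min_sep {f \<in> ?H. w f < W} c u v (Cut u v W)" if "{u, v} \<in> ?H" "W \<in> w ` E" for u v W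
    using cut that unfolding cut_choice_def by blast
  have CsH: "Cs \<subseteq> ?H" and CsB: "cost c D + cost c Cs \<le> B"
    and profit: "mst V ?H w + ereal (r * cost c Cs) \<le> mst V (?H - Cs) w"
  proof -
    have "Cs \<subseteq> ?H \<and> cost c D + cost c Cs \<le> B \<and>
      mst V ?H w + ereal (r * cost c Cs) \<le> mst V (?H - Cs) w"
      using alt
    proof
      assume "(\<forall>y\<in>cands Cut. ratio Cut y \<le> 0) \<and> r = 0 \<and> Cs = {}"
      then show ?thesis using D(2) by (simp add: cost_def)
    next
      assume "\<exists>x\<in>cands Cut. ratio Cut x > 0 \<and> (\<forall>y\<in>cands Cut. ratio Cut y \<le> ratio Cut x) \<and>
                 r = ratio Cut x \<and> Cs = (case x of (u, v, W) \<Rightarrow> Cut u v W)"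
      then obtain u v W where x: "(u, v, W) \<in> cands Cut" "r = ratio Cut (u, v, W)"
        "Cs = Cut u v W" by auto
      then have uv: "{u, v} \<in> ?H" "W \<in> w ` E" "cost c Cs > 0" "cost c D + cost c Cs \<le> B"
        by (auto simp: cands_def)
      have C: "min_sep {f \<in> ?H. w f < W} c u v Cs" using sep uv x(3) by simp
      have "r * cost c Cs = W - w {u, v}" using x uv(3) by (simp add: ratio_def)
      then show ?thesis
        using mst_min_sep[OF H(1,2) uv(1) C] uv(4) C unfolding min_sep_def by auto
    qed
    then show "Cs \<subseteq> ?H" "cost c D + cost c Cs \<le> B"
      "mst V ?H w + ereal (r * cost c Cs) \<le> mst V (?H - Cs) w" by auto
  qed
  have cost: "cost c (D \<union> Cs) = cost c D + cost c Cs"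
    unfolding cost_def using CsH D(1) finE
    by (intro sum.union_disjoint) (auto intro: finite_subset)
  have diff: "?H - Cs = E - (D \<union> Cs)" by blast
  have greedy: "W - w {u, v} \<le> r * K"
    if uv: "{u, v} \<in> ?H" "W \<in> w ` E" "w {u, v} < W" and K: "cost c D + K \<le> B"
      "\<And>C. min_sep {f \<in> ?H. w f < W} c u v C \<Longrightarrow> cost c C \<le> K" for u v W K
  proof -
    let ?C = "Cut u v W"
    have pos: "cost c ?C > 0"
      using min_sep_cost_pos[OF sep[OF uv(1,2)] uv(1,3)] H(3) finE by simp
    have le: "cost c ?C \<le> K" by (rule K(2)[OF sep[OF uv(1,2)]])
    have "ratio Cut (u, v, W) \<le> r"
      using uv pos le K(1) by (intro max) (auto simp: cands_def)
    then have "W - w {u, v} \<le> r * cost c ?C"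
      using pos by (simp add: ratio_def pos_divide_le_eq)
    \<comment> \<open>The gain is positive, hence so is \<open>r\<close>, and the cost may be
      enlarged to \<open>K\<close>.\<close>
    moreover from this have "r > 0" using uv(3) pos by (smt (verit) mult_nonpos_nonneg)
    ultimately show ?thesis using le by (smt (verit) mult_left_mono)
  qed
  show "H' = E - D'" using st'(1,3) diff by simp
  show "b' = cost c D'" using st'(2,3) cost by simp
  show "D \<subseteq> D'" using st'(3) by blast
  show "D' \<subseteq> E" using st'(3) CsH D(1) by blast
  show "cost c D' \<le> B" using st'(3) cost CsB by simp
  show "mst V ?H w + ereal (r * (cost c D' - cost c D)) \<le> mst V (E - D') w"
    using profit unfolding st'(3) cost diff by simp
  show "W - w {u, v} \<le> r * K"
    if "{u, v} \<in> ?H" "W \<in> w ` E" "w {u, v} < W" "cost c D + K \<le> B"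
      "\<And>C. min_sep {f \<in> ?H. w f < W} c u v C \<Longrightarrow> cost c C \<le> K" for u v W K
    using that by (rule greedy)
qed

section \<open>The approximation guarantee\<close>

text \<open>Indices with \<open>K i > B / 2\<close> satisfy \<open>W i - x i \<le> \<tau> < (2 * \<tau> / B) * K i\<close>, so an index beating the
  average ratio is automatically cheap.\<close>
lemma ex_cheap_gain:
  fixes m :: nat and W K x :: "nat \<Rightarrow> real"
  assumes "B > 0" "\<tau> > 0" and gain: "(\<Sum>i<m. W i) - (\<Sum>i<m. x i) > 2 * \<tau> / B * (\<Sum>i<m. K i)"
    and single: "\<And>i. i < m \<Longrightarrow> W i - x i \<le> \<tau>"
  obtains i where "i < m" "K i \<le> B / 2" "W i - x i > 2 * \<tau> / B * K i"
proof -
  have "\<exists>i\<in>{..<m}. 2 * \<tau> / B * K i < W i - x i"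
  proof (rule ccontr)
    assume "\<not> ?thesis"
    then have "(\<Sum>i<m. W i - x i) \<le> (\<Sum>i<m. 2 * \<tau> / B * K i)"
      by (intro sum_mono) (auto simp: not_less)
    then show False using gain by (simp add: sum_subtractf sum_distrib_left)
  qed
  then obtain i where i: "i < m" "2 * \<tau> / B * K i < W i - x i" by blast
  then have "2 * \<tau> / B * K i < \<tau>" using single[OF i(1)] by linarith
  then have "K i \<le> B / 2" using \<open>B > 0\<close> \<open>\<tau> > 0\<close> by (simp add: field_simps)
  then show ?thesis using that i by blast
qed

theorem mainTheorem17:
  fixes V :: "'v set" and E :: "'v set set" and w c :: "'v set \<Rightarrow> real"
    and B \<Delta> :: real and F Out :: "'v set set"
  assumes "simple_graph V E" and "connected_on V E" and "card V \<ge> 3"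
    and "\<forall>e\<in>E. w e \<ge> 0" and "\<forall>e\<in>E. c e > 0" and "B > 0"
    and "F \<subseteq> E" and "cost c F \<le> B" and "profit V E w F = ereal \<Delta>"
    and "procedure_output V E w c B Out"
  shows "cost c Out \<le> B \<and>
    profit V E w Out \<ge> ereal (\<Delta> / 4 * (1 / log 2 (card V) - 1 / (log 2 (card V))^2))"
proof -
  note E = assms(1,4,5) and conn = assms(2)
  have finE: "finite E" by (rule simple_graph_finite[OF E(1)])
  define L where "L = log 2 (card V)"
  define \<tau> where "\<tau> = \<Delta> / 4 * (1 / L - 1 / L^2)"
  have "L > 1" using assms(3) by (simp add: L_def)
  \<comment> \<open>\<open>\<tau>\<close> is chosen for this identity: the rate
    \<open>2 * \<tau> / B\<close> times the bound \<open>2 * L * B\<close> on the total cut cost is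
    \<open>\<Delta> - \<Delta> / L\<close>, which leaves \<open>\<Delta> / L\<close> for the profit
    already made.\<close>
  then have four: "4 * L * \<tau> = \<Delta> - \<Delta> / L"
    by (simp add: \<tau>_def field_simps power2_eq_square)

  obtain C0 Fg where ph1: "phase1_result V E w c B C0" and ph2: "phase2_result E w c B Fg"
    and Out: "Out = (if profit V E w C0 \<ge> profit V E w Fg then C0 else Fg)"
    using assms(10) unfolding procedure_output_def by blast
  obtain k s r where "k \<ge> 1" and s0: "s 0 = (E, 0, {})"
    and step: "\<And>i. i < k \<Longrightarrow> phase2_step E w c B (s i) (r i) (s (Suc i))"
    and r: "\<And>i. i < k \<Longrightarrow> 0 < r i \<longleftrightarrow> Suc i < k"
    and Fg: "Fg = snd (snd (s k))"
    using ph2 unfolding phase2_result_def by blast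
  define D where "D i = snd (snd (s i))" for i
  have s_Suc: "phase2_step E w c B (E - D i, cost c (D i), D i) (r i)
      (fst (s (Suc i)), fst (snd (s (Suc i))), D (Suc i))"
    if "i < k" "s i = (E - D i, cost c (D i), D i)" for i
    using step[OF that(1)] unfolding D_def[of "Suc i"] prod.collapse by (subst that(2)[symmetric])
  have inv: "s i = (E - D i, cost c (D i), D i) \<and> D i \<subseteq> E \<and> cost c (D i) \<le> B" if "i \<le> k" for i
    using that
  proof (induction i)
    case 0
    have "D 0 = {}" by (simp add: D_def s0)
    then show ?case using s0 \<open>B > 0\<close> by (simp add: cost_def)
  next
    case (Suc i)
    then have i: "i < k" "s i = (E - D i, cost c (D i), D i)" "D i \<subseteq> E" "cost c (D i) \<le> B"
      by simp_all
    note props = phase2_step_properties[OF s_Suc[OF i(1,2)] E i(3,4)]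
    show ?case
      using props(1,2,4,5) by (simp add: prod_eq_iff D_def[of "Suc i"])
  qed
  have D_step: "D i \<subseteq> D (Suc i)"
    "mst V (E - D i) w + ereal (r i * (cost c (D (Suc i)) - cost c (D i))) \<le> mst V (E - D (Suc i)) w"
    "\<And>u v W K. \<lbrakk>{u, v} \<in> E - D i; W \<in> w ` E; w {u, v} < W; cost c (D i) + K \<le> B;
        \<And>C. min_sep {f \<in> E - D i. w f < W} c u v C \<Longrightarrow> cost c C \<le> K\<rbrakk> \<Longrightarrow>
      W - w {u, v} \<le> r i * K" if i: "i < k" for i
  proof -
    have j: "s i = (E - D i, cost c (D i), D i)" "D i \<subseteq> E" "cost c (D i) \<le> B"
      using inv[of i] i by simp_all
    note props = phase2_step_properties[OF s_Suc[OF i j(1)] E j(2,3)]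
    show "D i \<subseteq> D (Suc i)" by (rule props(3))
    show "mst V (E - D i) w + ereal (r i * (cost c (D (Suc i)) - cost c (D i)))
        \<le> mst V (E - D (Suc i)) w"
      by (rule props(6))
    show "W - w {u, v} \<le> r i * K"
      if "{u, v} \<in> E - D i" "W \<in> w ` E" "w {u, v} < W" "cost c (D i) + K \<le> B"
        "\<And>C. min_sep {f \<in> E - D i. w f < W} c u v C \<Longrightarrow> cost c C \<le> K" for u v W K
      using that by (rule props(7))
  qed
  have Dk: "Fg = D k" by (simp add: D_def Fg)

  have "\<not> (profit V E w C0 < ereal \<tau> \<and> profit V E w Fg < ereal \<tau>)"
  proof
    assume low: "profit V E w C0 < ereal \<tau> \<and> profit V E w Fg < ereal \<tau>"
    \<comment> \<open>Profits are nonnegative, so the assumption already excludes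
      \<open>\<tau> \<le> 0\<close>.\<close>
    have "\<tau> > 0"
      using profit_nonneg[OF E(1,2) conn, of C0] low
      by (metis ereal_less(2) le_less_trans)
    have "\<tau> = \<Delta> * ((L - 1) / (4 * L^2))"
      using \<open>L > 1\<close> by (simp add: \<tau>_def field_simps power2_eq_square)
    moreover have "(L - 1) / (4 * L^2) > 0" using \<open>L > 1\<close> by simp
    ultimately have "\<Delta> > 0" using \<open>\<tau> > 0\<close> by (metis zero_less_mult_pos2)
    have "L * \<tau> > 0" "\<Delta> / L > 0" using \<open>\<tau> > 0\<close> \<open>\<Delta> > 0\<close> \<open>L > 1\<close> by simp_all
    then have "L * \<tau> \<le> \<Delta>" using four by linarith
    then have "\<tau> \<le> \<Delta> / L" using \<open>L > 1\<close> by (simp add: pos_le_divide_eq mult.commute)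

    obtain M0 where M0: "mst V E w = ereal M0"
      using ex_minimum_spanning_tree[OF finE conn] by metis
    have MF: "mst V (E - F) w = ereal (M0 + \<Delta>)"
      using assms(9) M0 unfolding profit_def by (cases "mst V (E - F) w") auto
    \<comment> \<open>Deleting more edges never lowers the weight, so the low profit of the final
      set \<open>D k\<close> bounds the weight at every stage and keeps every \<open>E - D i\<close>
      connected.\<close>
    have Mfin: "\<exists>x. mst V (E - D i) w = ereal x \<and> x < M0 + \<tau>" if "i \<le> k" for i
    proof -
      have "D i \<subseteq> D k"
        using that by (induction rule: inc_induct) (use D_step(1) in auto)
      then have "mst V (E - D i) w \<le> mst V (E - D k) w"
        using mst_antimono[of "E - D i" w "E - D k" V] finE E(2) by auto
      also have "mst V (E - D k) w < ereal (M0 + \<tau>)"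
        using low M0 unfolding Dk profit_def by (cases "mst V (E - D k) w") auto
      finally have "mst V (E - D i) w < ereal (M0 + \<tau>)" .
      moreover have "ereal M0 \<le> mst V (E - D i) w"
        using mst_antimono[OF finE E(2), of "E - D i" V] M0 by auto
      ultimately show ?thesis by (cases "mst V (E - D i) w") auto
    qed
    then obtain M where M: "\<And>i. i \<le> k \<Longrightarrow> mst V (E - D i) w = ereal (M i)"
      and M_less: "\<And>i. i \<le> k \<Longrightarrow> M i < M0 + \<tau>"
      by metis

    have R: "simple_graph V (E - F)" "\<forall>e\<in>E - F. w e \<ge> 0" "connected_on V (E - F)"
      using simple_graph_mono[OF E(1), of "E - F"] E(2) MF mst_not_infinity_imp_connected[of V "E - F" w]
      by auto
    \<comment> \<open>The family comes from the graph without \<open>F\<close>, whose minimum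
      spanning tree weighs \<open>M0 + \<Delta>\<close>; its transversals are taken later in the
      graphs \<open>E - D j\<close>.\<close>
    obtain m :: nat and W S where W: "\<forall>i<m. W i \<in> w ` (E - F)" "mst V (E - F) w = ereal (\<Sum>i<m. W i)"
      and S: "\<forall>i<m. \<forall>g\<in>E - F. w g < W i \<longrightarrow> \<not> crosses g (S i)"
        "\<forall>x\<in>V. 2 ^ card {i. i < m \<and> x \<in> S i} \<le> card V"
      and transversal: "\<forall>T. connected_on V T \<longrightarrow>
        (\<exists>\<phi>. inj_on \<phi> {..<m} \<and> \<phi> ` {..<m} \<subseteq> T \<and> (\<forall>i<m. crosses (\<phi> i) (S i)))"
      by (rule bottleneck_cut_family[OF R])
    define K where "K i = cost c {f \<in> F. crosses f (S i) \<and> w f < W i}" for i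
    have F: "finite F" "\<forall>f\<in>F. c f \<ge> 0" "simple_graph V F"
      using assms(7) finE E finite_subset simple_graph_mono by (auto simp: less_imp_le)
    have KB: "K i \<le> B" for i
    proof -
      have "K i \<le> cost c F"
        unfolding K_def cost_def using F by (intro sum_mono2) auto
      then show ?thesis using assms(8) by simp
    qed
    have "(\<Sum>i<m. K i) \<le> 2 * L * cost c F"
      unfolding K_def L_def using F S(2) assms(3) by (intro sum_crossing_cost_le) auto
    also have "\<dots> \<le> 2 * L * B" using assms(8) \<open>L > 1\<close> by simp
    finally have K_sum: "(\<Sum>i<m. K i) \<le> 2 * L * B" .
    \<comment> \<open>\<open>H\<close> is arbitrary because the bound serves both phases, with
      \<open>H = E\<close> and with \<open>H = E - D j\<close>.\<close>
    have K_cut: "cost c C \<le> K i"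
      if "i < m" "u \<in> S i" "v \<notin> S i" "H \<subseteq> E" "min_sep {f \<in> H. w f < W i} c u v C" for i u v H C
      unfolding K_def using that S(1) F by (intro min_sep_cost_le[of H w]) auto
    \<comment> \<open>The minimum cut for \<open>f\<close> and \<open>W i\<close> is affordable by
      \<open>KB\<close>, so a gain above \<open>\<tau>\<close> would have given phase 1 a profit
      above \<open>\<tau>\<close>.\<close>
    have single: "W i - w f \<le> \<tau>" if i: "i < m" and f: "f \<in> E" "crosses f (S i)" for i f
    proof -
      obtain u v where uv: "f = {u, v}" "u \<in> S i" "v \<notin> S i"
        using f(2) unfolding crosses_def by blast
      have "ereal (W i - w {u, v}) \<le> profit V E w C0"
      proof (rule phase1_result_profit[OF ph1 E(1,2) conn])
        show "{u, v} \<in> E" "W i \<in> w ` E" using f(1) uv(1) W(1) i by auto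
        show "cost c C \<le> B" if "min_sep {f \<in> E. w f < W i} c u v C" for C
          using K_cut[OF i uv(2,3) order_refl that] KB[of i] by linarith
      qed
      also have "\<dots> < ereal \<tau>" using low by blast
      finally show ?thesis using uv(1) by simp
    qed

    have ratio: "r j > 2 * \<tau> / B" if j: "j < k" "cost c (D j) \<le> B / 2" for j
    proof -
      have finH: "finite (E - D j)" and "connected_on V (E - D j)"
        using finE M[of j] j(1) mst_not_infinity_imp_connected[of V "E - D j" w] by auto
      then obtain T where T: "spanning_tree V (E - D j) T" "mst V (E - D j) w = ereal (sum w T)"
        using ex_minimum_spanning_tree by blast
      have TE: "T \<subseteq> E - D j" "connected_on V T" using T(1) by (auto simp: spanning_tree_def)
      then obtain \<phi> where \<phi>: "inj_on \<phi> {..<m}" "\<phi> ` {..<m} \<subseteq> T" "\<forall>i<m. crosses (\<phi> i) (S i)"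
        using transversal by blast
      have "(\<Sum>i<m. w (\<phi> i)) = sum w (\<phi> ` {..<m})"
        using \<phi>(1) by (simp add: sum.reindex)
      also have "\<dots> \<le> sum w T"
        using \<phi>(2) TE E(2) finH by (intro sum_mono2) (auto intro: finite_subset)
      also have "\<dots> = M j" using T(2) M[of j] j(1) by simp
      also have "\<dots> < M0 + \<tau>" using M_less[of j] j(1) by simp
      \<comment> \<open>The \<open>W i\<close> sum to \<open>M0 + \<Delta>\<close>, while the
        \<open>\<phi> i\<close> are distinct edges of a tree of weight below
        \<open>M0 + \<tau>\<close>.\<close>
      finally have "(\<Sum>i<m. W i) - (\<Sum>i<m. w (\<phi> i)) > \<Delta> - \<tau>"
        using MF W(2) by simp
      moreover have "2 * \<tau> / B * (\<Sum>i<m. K i) \<le> 2 * \<tau> / B * (2 * L * B)"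
        using K_sum \<open>\<tau> > 0\<close> \<open>B > 0\<close> by (intro mult_left_mono) auto
      moreover have "2 * \<tau> / B * (2 * L * B) = \<Delta> - \<Delta> / L"
        using four \<open>B > 0\<close> by (simp add: algebra_simps)
      ultimately have gain: "(\<Sum>i<m. W i) - (\<Sum>i<m. w (\<phi> i)) > 2 * \<tau> / B * (\<Sum>i<m. K i)"
        using \<open>\<tau> \<le> \<Delta> / L\<close> by linarith
      \<comment> \<open>\<open>K i \<le> B / 2\<close> together with
        \<open>cost c (D j) \<le> B / 2\<close> makes this cut affordable, so the greedy step does
        at least as well.\<close>
      obtain i where i: "i < m" "K i \<le> B / 2" "W i - w (\<phi> i) > 2 * \<tau> / B * K i"
        using ex_cheap_gain[OF \<open>B > 0\<close> \<open>\<tau> > 0\<close> gain] single \<phi> TE by blast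
      obtain u v where uv: "\<phi> i = {u, v}" "u \<in> S i" "v \<notin> S i"
        using \<phi>(3) i(1) unfolding crosses_def by blast
      have "K i \<ge> 0" unfolding K_def cost_def using F by (intro sum_nonneg) auto
      then have "2 * \<tau> / B * K i \<ge> 0" using \<open>\<tau> > 0\<close> \<open>B > 0\<close> by simp
      then have "w {u, v} < W i" using i(3) uv(1) by simp
      moreover have "{u, v} \<in> E - D j" using \<phi>(2) TE i(1) uv(1) by auto
      ultimately have "W i - w {u, v} \<le> r j * K i"
        using W(1) i(1,2) j(2) K_cut[OF i(1) uv(2,3), of "E - D j"]
        by (intro D_step(3)[OF j(1)]) auto
      then have "2 * \<tau> / B * K i < r j * K i" using i(3) uv(1) by simp
      then show ?thesis using \<open>K i \<ge> 0\<close> mult_right_less_imp_less by blast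
    qed

    have D_mono: "cost c (D j) \<le> cost c (D (Suc j))" if "j < k" for j
      unfolding cost_def using D_step(1)[OF that] inv[of "Suc j"] that E(3) finE
      by (intro sum_mono2) (auto intro: finite_subset less_imp_le)
    have M_step: "M j + r j * (cost c (D (Suc j)) - cost c (D j)) \<le> M (Suc j)" if "j < k" for j
      using D_step(2)[OF that] M[of j] M[of "Suc j"] that by simp
    \<comment> \<open>The cost is capped at \<open>B / 2\<close> since beyond it
      \<open>ratio\<close> says nothing and only \<open>r j > 0\<close> is left. With
      \<open>j < k\<close> the induction stops before the last step, the only one without a positive
      rate.\<close>
    have growth: "M0 + 2 * \<tau> / B * min (cost c (D j)) (B / 2) \<le> M j" if "j < k" for j
      using that
    proof (induction j)
      case 0
      have "D 0 = {}" by (simp add: D_def s0)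
      then show ?case using M[of 0] M0 \<open>B > 0\<close> by (simp add: cost_def)
    next
      case (Suc j)
      let ?b = "cost c (D j)" and ?b' = "cost c (D (Suc j))"
      have IH: "M0 + 2 * \<tau> / B * min ?b (B / 2) \<le> M j" using Suc by simp
      have "j < k" "r j > 0" using Suc.prems r[of j] by auto
      have "?b \<le> ?b'" by (rule D_mono[OF \<open>j < k\<close>])
      have pos: "2 * \<tau> / B > 0" using \<open>\<tau> > 0\<close> \<open>B > 0\<close> by simp
      have "2 * \<tau> / B * (min ?b' (B / 2) - min ?b (B / 2)) \<le> r j * (?b' - ?b)"
      proof (cases "?b \<le> B / 2")
        case True
        then show ?thesis
          using ratio[OF \<open>j < k\<close> True] pos \<open>?b \<le> ?b'\<close> by (intro mult_mono) auto
      next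
        case False
        then show ?thesis using \<open>?b \<le> ?b'\<close> \<open>r j > 0\<close> by (simp add: min_def)
      qed
      then show ?case using IH M_step[OF \<open>j < k\<close>] by (simp add: right_diff_distrib)
    qed
    \<comment> \<open>Step \<open>l\<close> is the last one and its rate is not positive, so by
      \<open>ratio\<close> more than half of the budget was spent before it. In
      \<open>growth\<close> the capped cost \<open>B / 2\<close> is then worth exactly
      \<open>\<tau>\<close>.\<close>
    define l where "l = k - 1"
    have l: "l < k" "\<not> r l > 0" using \<open>k \<ge> 1\<close> r[of l] by (auto simp: l_def)
    moreover have "2 * \<tau> / B > 0" using \<open>\<tau> > 0\<close> \<open>B > 0\<close> by simp
    ultimately have "cost c (D l) > B / 2" using ratio[OF l(1)] by linarith
    then have "M0 + \<tau> \<le> M l" using growth[OF l(1)] \<open>B > 0\<close> by simp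
    then show False using M_less[of l] l(1) by simp
  qed
  then have "profit V E w Out \<ge> ereal \<tau>"
    unfolding Out by (auto simp: not_less intro: order_trans)
  moreover have "cost c Out \<le> B"
    using Out Dk inv[of k] phase1_result_cost[OF ph1 \<open>B > 0\<close>] by auto
  ultimately show ?thesis by (simp add: \<tau>_def L_def)
qed

end
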